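(* Let $\alpha \in (0,1]$ and $\beta >0$. Suppose that, for some $C<\infty$, $\mathbb{E} [ (\Delta_t^+)^\alpha \mid \mathcal{F}_t ] \leq C$ a.s. for all $t \in \mathbb{Z}^+$, and $\mathbb{E} [ (\Delta_t^-)^\beta \mid \mathcal{F}_t ] = \infty$ a.s. for all $t \in \mathbb{Z}^+$. Then, for any $x>0$, $\mathbb{E} [ \tau_x^{\beta/\alpha} ] =\infty$.
   Context: $\mathbb{Z}^+ = \{0,1,2,\ldots\}$. $(X_t)_{t \in \mathbb{Z}^+}$ is a real-valued stochastic process adapted to a filtration $(\mathcal{F}_t)_{t \in \mathbb{Z}^+}$, with $X_0 = 0$ (no Markov property is assumed). Its increments are $\Delta_t := X_{t+1} - X_t$. For real $x$, $x^+ := x \mathbf{1}\{x>0\}$ and $x^- := -x\mathbf{1}\{x<0\}$; $\Delta_t^\pm := (\Delta_t)^\pm$. For $x \in \mathbb{R}$, $\tau_x := \min \{ t \in \mathbb{Z}^+ : X_t \geq x \}$ is the first passage time into $[x,\infty)$, with $\min \emptyset := \infty$. The constant $C$ is non-random and does not depend on $t$. *)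

theory Defs
  imports "HOL-Probability.Probability"
begin

definition rpos :: "real \<Rightarrow> real"
  where "rpos x = x * indicator {x. x > 0} x"

definition rneg :: "real \<Rightarrow> real"
  where "rneg x = - x * indicator {x. x < 0} x"

definition increment :: "(nat \<Rightarrow> 'a \<Rightarrow> real) \<Rightarrow> nat \<Rightarrow> 'a \<Rightarrow> real"
  where "increment X t \<omega> = X (t + 1) \<omega> - X t \<omega>"

(* Sub-sigma-algebras are encoded as measures F t on the same space, of which only the
   space and the measurable sets matter; the measure is always that of M. *)
definition adapted_process ::
  "'a measure \<Rightarrow> (nat \<Rightarrow> 'a measure) \<Rightarrow> (nat \<Rightarrow> 'a \<Rightarrow> real) \<Rightarrow> bool"
  where "adapted_process M F X \<longleftrightarrow>
    filtration (space M) F \<and> (\<forall>t. subalgebra M (F t)) \<and> (\<forall>t. X t \<in> borel_measurable (F t))"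

(* In enat the infimum of a nonempty set is its minimum, and Inf {} = \<infinity>. *)
definition first_passage :: "(nat \<Rightarrow> 'a \<Rightarrow> real) \<Rightarrow> real \<Rightarrow> 'a \<Rightarrow> enat"
  where "first_passage X x \<omega> = Inf (enat ` {t. X t \<omega> \<ge> x})"

(* Intended for exponents p > 0, where \<infinity> to the power p is \<infinity>. *)
definition enat_powr :: "enat \<Rightarrow> real \<Rightarrow> ennreal"
  where "enat_powr n p = (case n of enat k \<Rightarrow> ennreal (real k powr p) | \<infinity> \<Rightarrow> \<infinity>)"

end

theory Submission
  imports Defs
begin

text \<open>
  The first step alone makes the moment infinite. Taking expectations in the hypothesis at
  time \<open>0\<close> gives \<open>\<E>[Y powr \<beta>] = \<infinity>\<close>, where \<open>Y = (X\<^sub>1)\<^sup>-\<close> is the depth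
  of the first step below the origin. What remains is to show that a climb out of depth \<open>Y\<close> takes,
  with probability at least one half, a time of at least order \<open>Y powr \<alpha>\<close>; raising this to the power
  \<open>\<beta> / \<alpha>\<close> turns it into \<open>Y powr \<beta>\<close>.

  To reach \<open>x > 0\<close> by time \<open>n\<close> after a first step to \<open>- Y\<close>, the upward increments after time \<open>1\<close>
  must add up to at least \<open>Y\<close>. As \<open>\<alpha> \<le> 1\<close>, powers with exponent \<open>\<alpha>\<close> are subadditive
  (\<open>powr_sum_le\<close>), so the sum of the \<open>(\<Delta>\<^sub>s\<^sup>+) powr \<alpha>\<close> over \<open>1 \<le> s < n\<close> is then at least
  \<open>Y powr \<alpha>\<close> (\<open>rneg_powr_le_sum_rpos_powr\<close>). Given \<open>\<F>\<^sub>1\<close> this sum has mean at most \<open>c n\<close> for any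
  positive upper bound \<open>c\<close> of \<open>C\<close>. Hence, by Markov's inequality, on any event of \<open>\<F>\<^sub>1\<close> on
  which \<open>Y powr \<alpha> \<ge> 2 c n\<close>, the level is still not reached at time \<open>n\<close> with conditional probability at
  least one half (\<open>emeasure_le_twice_emeasure_unpassed\<close>).

  The largest such \<open>n\<close> depends on \<open>Y\<close>: it is \<open>N = \<lfloor>Y powr \<alpha> / (2 c)\<rfloor>\<close>. Applying the estimate on
  each event \<open>N = n\<close> and adding up (\<open>nn_integral_nat_level_le\<close>) gives
  \<open>\<E>[(N + 1) powr (\<beta> / \<alpha>)] \<le> 2 \<E>[\<tau>\<^sub>x powr (\<beta> / \<alpha>)]\<close>, and \<open>(N + 1) powr (\<beta> / \<alpha>)\<close> is at least a
  positive constant times \<open>Y powr \<beta>\<close>.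
\<close>

section \<open>Subadditivity of powers\<close>

text \<open>
  Normalising to \<open>a + b = 1\<close>, the inequality follows from \<open>u \<le> u powr p\<close> on the unit interval,
  applied to the two shares \<open>a / (a + b)\<close> and \<open>b / (a + b)\<close>.
\<close>

lemma powr_add_le:
  fixes a b p :: real
  assumes "0 \<le> a" "0 \<le> b" "0 < p" "p \<le> 1"
  shows "(a + b) powr p \<le> a powr p + b powr p"
proof (cases "a + b = 0")
  case False
  then have pos: "a + b > 0" using assms by simp
  have frac: "u \<le> u powr p" if "0 \<le> u" "u \<le> 1" for u :: real
    using that assms powr_mono'[of p 1 u] by (cases "u = 0") auto
  have "1 = a / (a + b) + b / (a + b)"
    using pos by (simp add: add_divide_distrib[symmetric])
  also have "\<dots> \<le> (a / (a + b)) powr p + (b / (a + b)) powr p"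
    by (intro add_mono frac) (use assms pos in auto)
  also have "\<dots> = (a powr p + b powr p) / (a + b) powr p"
    using assms by (simp add: powr_divide add_divide_distrib)
  finally show ?thesis using pos by (simp add: field_simps)
qed (use assms in auto)

lemma powr_sum_le:
  fixes f :: "'i \<Rightarrow> real"
  assumes "finite I" "\<And>i. i \<in> I \<Longrightarrow> 0 \<le> f i" "0 < p" "p \<le> 1"
  shows "(\<Sum>i\<in>I. f i) powr p \<le> (\<Sum>i\<in>I. f i powr p)"
  using assms(1,2)
proof (induction I rule: finite_induct)
  case (insert j I)
  have "(f j + sum f I) powr p \<le> f j powr p + sum f I powr p"
    using insert.prems assms by (intro powr_add_le sum_nonneg) auto
  with insert show ?case by fastforce
qed simp

section \<open>Climbing out of a first downward step\<close>

lemma rpos_nonneg: "0 \<le> rpos y" and le_rpos: "y \<le> rpos y"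
  by (auto simp: rpos_def indicator_def)

lemma rneg_nonneg: "0 \<le> rneg y" and neg_eq_rneg: "0 < rneg y \<Longrightarrow> y = - rneg y"
  by (auto simp: rneg_def indicator_def split: if_splits)

lemma measurable_rpos [measurable]: "rpos \<in> borel_measurable borel"
  and measurable_rneg [measurable]: "rneg \<in> borel_measurable borel"
  unfolding rpos_def[abs_def] rneg_def[abs_def] by measurable

text \<open>
  The deterministic core: the path must regain the depth of its first step using upward
  increments only, and subadditivity lets their \<open>\<alpha>\<close>-th powers, whose conditional means are
  controlled, measure the climb. The first step is downward, so it does not contribute to the sum.
\<close>

lemma rneg_powr_le_sum_rpos_powr:
  assumes "0 < rneg (X 1 \<omega>)" "X 0 \<omega> < x" "0 \<le> x" "0 < \<alpha>" "\<alpha> \<le> 1"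
    and "t \<le> n" "x \<le> X t \<omega>"
  shows "rneg (X 1 \<omega>) powr \<alpha> \<le> (\<Sum>s = 1..<n. rpos (increment X s \<omega>) powr \<alpha>)"
proof -
  have X1: "X 1 \<omega> = - rneg (X 1 \<omega>)" using assms(1) by (rule neg_eq_rneg)
  have t: "1 \<le> t" using assms by (cases t) auto
  have "rneg (X 1 \<omega>) \<le> X t \<omega> - X 1 \<omega>" using X1 assms by linarith
  also have "\<dots> = (\<Sum>s = 1..<t. increment X s \<omega>)"
    using sum_Suc_diff'[OF t, of "\<lambda>s. X s \<omega>"] by (simp add: increment_def)
  also have "\<dots> \<le> (\<Sum>s = 1..<t. rpos (increment X s \<omega>))"
    by (intro sum_mono le_rpos)
  also have "\<dots> \<le> (\<Sum>s = 1..<n. rpos (increment X s \<omega>))"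
    using assms by (intro sum_mono2) (auto simp: rpos_nonneg)
  finally have "rneg (X 1 \<omega>) powr \<alpha> \<le> (\<Sum>s = 1..<n. rpos (increment X s \<omega>)) powr \<alpha>"
    using assms by (intro powr_mono2) auto
  also have "\<dots> \<le> (\<Sum>s = 1..<n. rpos (increment X s \<omega>) powr \<alpha>)"
    using assms by (intro powr_sum_le) (auto simp: rpos_nonneg)
  finally show ?thesis .
qed

section \<open>The climb is slow with probability at least one half\<close>

lemma nn_integral_indicator_le_of_nn_cond_exp_le:
  assumes "sigma_finite_subalgebra M G" "A \<in> sets G" "f \<in> borel_measurable M"
    and "AE \<omega> in M. nn_cond_exp M G f \<omega> \<le> C"
  shows "(\<integral>\<^sup>+ \<omega>. indicator A \<omega> * f \<omega> \<partial>M) \<le> C * emeasure M A"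
proof -
  interpret sigma_finite_subalgebra M G by fact
  have A: "A \<in> sets M" using assms(2) subalg by (auto simp: subalgebra_def)
  have "(\<integral>\<^sup>+ \<omega>. indicator A \<omega> * f \<omega> \<partial>M) = (\<integral>\<^sup>+ \<omega>. indicator A \<omega> * nn_cond_exp M G f \<omega> \<partial>M)"
    using assms by (intro nn_cond_exp_intg[symmetric]) auto
  also have "\<dots> \<le> (\<integral>\<^sup>+ \<omega>. C * indicator A \<omega> \<partial>M)"
    using assms(4) by (intro nn_integral_mono_AE) (auto simp: indicator_def)
  finally show ?thesis using A by (simp add: nn_integral_cmult_indicator)
qed

text \<open>
  Markov's inequality for the sum of the \<open>\<alpha>\<close>-th powers of the upward increments, whose integral
  over \<open>A\<close> is at most \<open>c n\<close> times the measure of \<open>A\<close>: the bound at time \<open>s\<close> may be integrated over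
  \<open>A\<close> because \<open>A\<close> is an event of \<open>F 1\<close> and only times \<open>s \<ge> 1\<close> occur. The factor \<open>2\<close> in the
  depth condition is what leaves half of \<open>A\<close> below the level.
\<close>

lemma emeasure_le_twice_emeasure_unpassed:
  fixes c :: real
  assumes "prob_space M" "adapted_process M F X"
    and X0: "\<And>\<omega>. \<omega> \<in> space M \<Longrightarrow> X 0 \<omega> = 0"
    and \<alpha>: "0 < \<alpha>" "\<alpha> \<le> 1" and "0 < x" "0 < c"
    and up: "\<And>t. AE \<omega> in M. nn_cond_exp M (F t)
               (\<lambda>\<omega>. ennreal (rpos (increment X t \<omega>) powr \<alpha>)) \<omega> \<le> ennreal c"
    and A: "A \<in> sets (F 1)"
    and deep: "\<And>\<omega>. \<omega> \<in> A \<Longrightarrow> 2 * c * real n \<le> rneg (X 1 \<omega>) powr \<alpha>"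
  shows "emeasure M A \<le> 2 * emeasure M (A \<inter> {\<omega> \<in> space M. \<forall>t\<le>n. X t \<omega> < x})"
proof -
  interpret prob_space M by fact
  have sub: "subalgebra M (F t)" and Xt: "X t \<in> borel_measurable (F t)"
    and mono: "s \<le> t \<Longrightarrow> sets (F s) \<subseteq> sets (F t)" for s t
    using assms(2) by (auto simp: adapted_process_def filtration_def)
  have XM [measurable]: "X t \<in> borel_measurable M" for t
    using measurable_from_subalg[OF sub Xt] .
  have incM [measurable]: "increment X t \<in> borel_measurable M" for t
    unfolding increment_def[abs_def] by measurable
  have AM [measurable]: "A \<in> sets M" using A sub by (auto simp: subalgebra_def)
  have Asp: "A \<subseteq> space M" using sets.sets_into_space[OF AM] .
  define B where "B = {\<omega> \<in> space M. \<forall>t\<le>n. X t \<omega> < x}"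
  have BM [measurable]: "B \<in> sets M" unfolding B_def by measurable
  define S where "S \<omega> = (\<Sum>s = 1..<n. rpos (increment X s \<omega>) powr \<alpha>)" for \<omega>
  have half: "2 * measure M (A - B) \<le> measure M A"
  proof (cases "n = 0")
    case True
    \<comment> \<open>Markov's inequality is void for \<open>n = 0\<close>, but a path starting at \<open>0 < x\<close> has not passed yet.\<close>
    then have "A - B = {}" using Asp X0 \<open>0 < x\<close> by (auto simp: B_def)
    then have "measure M (A - B) = 0" by (simp only: measure_empty)
    then show ?thesis by simp
  next
    case False
    have S_ge: "2 * c * real n \<le> S \<omega>" if "\<omega> \<in> A - B" for \<omega>
    proof -
      from that Asp obtain t where t: "t \<le> n" "x \<le> X t \<omega>"
        by (auto simp: B_def not_less)
      have "0 < 2 * c * real n" using False \<open>0 < c\<close> by simp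
      also have "\<dots> \<le> rneg (X 1 \<omega>) powr \<alpha>" using deep that by auto
      finally have "0 < rneg (X 1 \<omega>)" using rneg_nonneg[of "X 1 \<omega>"]
        by (cases "rneg (X 1 \<omega>) = 0") auto
      moreover have "X 0 \<omega> < x" using X0 that Asp \<open>0 < x\<close> by auto
      ultimately have "rneg (X 1 \<omega>) powr \<alpha> \<le> S \<omega>"
        unfolding S_def using t \<alpha> \<open>0 < x\<close> by (intro rneg_powr_le_sum_rpos_powr) auto
      with deep[of \<omega>] that show ?thesis by auto
    qed
    have "ennreal (2 * c * real n) * emeasure M (A - B)
        = (\<integral>\<^sup>+ \<omega>. ennreal (2 * c * real n) * indicator (A - B) \<omega> \<partial>M)"
      by (simp add: nn_integral_cmult_indicator)
    also have "\<dots> \<le> (\<integral>\<^sup>+ \<omega>. indicator A \<omega> * ennreal (S \<omega>) \<partial>M)"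
      using S_ge by (intro nn_integral_mono) (auto simp: indicator_def intro!: ennreal_leI)
    also have "\<dots> = (\<integral>\<^sup>+ \<omega>. (\<Sum>s = 1..<n. indicator A \<omega> * ennreal (rpos (increment X s \<omega>) powr \<alpha>)) \<partial>M)"
      unfolding S_def sum_distrib_left[symmetric] by (subst sum_ennreal) simp_all
    also have "\<dots> = (\<Sum>s = 1..<n. \<integral>\<^sup>+ \<omega>. indicator A \<omega> * ennreal (rpos (increment X s \<omega>) powr \<alpha>) \<partial>M)"
      by (rule nn_integral_sum) measurable
    also have "\<dots> \<le> (\<Sum>s = 1..<n. ennreal c * emeasure M A)"
    proof (intro sum_mono nn_integral_indicator_le_of_nn_cond_exp_le)
      fix s assume "s \<in> {1..<n}"
      then show "A \<in> sets (F s)" using A mono[of 1 s] by auto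
      show "sigma_finite_subalgebra M (F s)"
        using sub
        by (intro finite_measure_subalgebra_is_sigma_finite finite_measure_subalgebra.intro
              finite_measure_subalgebra_axioms.intro) (auto intro: finite_measure_axioms)
    qed (use up in measurable)
    also have "\<dots> \<le> (\<Sum>s < n. ennreal c * emeasure M A)"
      by (intro sum_mono2) auto
    also have "\<dots> = ennreal (real n * c) * emeasure M A"
      using \<open>0 < c\<close> by (simp add: ennreal_mult ennreal_of_nat_eq_real_of_nat mult.assoc)
    finally have "2 * c * real n * measure M (A - B) \<le> real n * c * measure M A"
      using \<open>0 < c\<close> by (simp add: emeasure_eq_measure ennreal_mult[symmetric])
    then show ?thesis
      using \<open>0 < c\<close> False by (simp add: field_simps)
  qed
  have "measure M A = measure M (A \<inter> B) + measure M (A - B)"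
    using finite_measure_Union[of "A \<inter> B" "A - B"] by (simp add: Int_Diff_Un Int_Diff_disjoint)
  with half have "measure M A \<le> 2 * measure M (A \<inter> B)" by linarith
  then show ?thesis
    unfolding B_def[symmetric]
    by (simp add: emeasure_eq_measure flip: ennreal_numeral ennreal_mult)
qed

section \<open>From tail bounds to moments\<close>

lemma enat_powr_first_passage_ge:
  assumes "\<forall>t\<le>n. X t \<omega> < x" "0 \<le> p"
  shows "ennreal (real (Suc n) powr p) \<le> enat_powr (first_passage X x \<omega>) p"
proof (cases "first_passage X x \<omega>")
  case (enat k)
  then have "enat k \<in> enat ` {t. X t \<omega> \<ge> x}"
    unfolding first_passage_def
    by (metis Inf_enat_def LeastI_ex all_not_in_conv enat.distinct(2) infinity_ileE)
  then have "Suc n \<le> k" using assms(1) by (auto simp: Suc_le_eq not_le[symmetric])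
  then show ?thesis using enat assms(2) by (auto simp: enat_powr_def intro!: ennreal_leI powr_mono2)
qed (simp add: enat_powr_def)

text \<open>
  This replaces conditioning on the random time \<open>N\<close>: the events \<open>N = n\<close> partition the space, so the
  bounds for fixed \<open>n\<close> may be added with the weights \<open>g n\<close>, while at each point only the summand
  \<open>n = N \<omega>\<close> survives.
\<close>

lemma nn_integral_nat_level_le:
  fixes N :: "'a \<Rightarrow> nat" and g :: "nat \<Rightarrow> ennreal"
  assumes [measurable]: "N \<in> measurable M (count_space UNIV)" "\<And>n. B n \<in> sets M"
    and le: "\<And>n. emeasure M {\<omega> \<in> space M. N \<omega> = n} \<le> K * emeasure M ({\<omega> \<in> space M. N \<omega> = n} \<inter> B n)"
    and T: "\<And>n \<omega>. \<omega> \<in> B n \<Longrightarrow> g n \<le> T \<omega>"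
  shows "(\<integral>\<^sup>+ \<omega>. g (N \<omega>) \<partial>M) \<le> K * (\<integral>\<^sup>+ \<omega>. T \<omega> \<partial>M)"
proof -
  define A where "A n = {\<omega> \<in> space M. N \<omega> = n}" for n
  have AM [measurable]: "A n \<in> sets M" for n unfolding A_def by measurable
  have levels: "(\<Sum>n. f n * indicator (A n \<inter> D n) \<omega>) = f (N \<omega>) * indicator (D (N \<omega>)) \<omega>"
    if "\<omega> \<in> space M" for f :: "nat \<Rightarrow> ennreal" and D \<omega>
  proof -
    have "(\<Sum>n. f n * indicator (A n \<inter> D n) \<omega>) = (\<Sum>n\<in>{N \<omega>}. f n * indicator (A n \<inter> D n) \<omega>)"
      by (rule suminf_finite) (auto simp: A_def)
    with that show ?thesis by (simp add: A_def indicator_def)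
  qed
  have "(\<integral>\<^sup>+ \<omega>. g (N \<omega>) \<partial>M) = (\<integral>\<^sup>+ \<omega>. (\<Sum>n. g n * indicator (A n) \<omega>) \<partial>M)"
    using levels[where D = "\<lambda>_. UNIV"] by (intro nn_integral_cong) auto
  also have "\<dots> = (\<Sum>n. g n * emeasure M (A n))"
    by (subst nn_integral_suminf) (auto simp: nn_integral_cmult_indicator)
  also have "\<dots> \<le> (\<Sum>n. K * (g n * emeasure M (A n \<inter> B n)))"
    using mult_left_mono[OF le[folded A_def]] by (intro suminf_le) (auto simp: mult.left_commute[of K])
  also have "\<dots> = K * (\<Sum>n. g n * emeasure M (A n \<inter> B n))"
    by simp
  also have "(\<Sum>n. g n * emeasure M (A n \<inter> B n)) = (\<integral>\<^sup>+ \<omega>. (\<Sum>n. g n * indicator (A n \<inter> B n) \<omega>) \<partial>M)"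
    by (subst nn_integral_suminf) (auto simp: nn_integral_cmult_indicator)
  also have "\<dots> \<le> (\<integral>\<^sup>+ \<omega>. T \<omega> \<partial>M)"
    using T by (intro nn_integral_mono) (simp only: levels, auto simp: indicator_def)
  finally show ?thesis by (simp add: mult_left_mono)
qed

theorem theorem2p5:
  fixes M :: "'a measure" and F :: "nat \<Rightarrow> 'a measure" and X :: "nat \<Rightarrow> 'a \<Rightarrow> real"
    and \<alpha> \<beta> x :: real and C :: ennreal
  assumes "prob_space M"
    and "adapted_process M F X"
    and "\<And>\<omega>. \<omega> \<in> space M \<Longrightarrow> X 0 \<omega> = 0"
    and "0 < \<alpha>" and "\<alpha> \<le> 1" and "\<beta> > 0"
    and "C < \<infinity>"
    and "\<And>t. AE \<omega> in M. nn_cond_exp M (F t) (\<lambda>\<omega>. ennreal (rpos (increment X t \<omega>) powr \<alpha>)) \<omega> \<le> C"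
    and "\<And>t. AE \<omega> in M. nn_cond_exp M (F t) (\<lambda>\<omega>. ennreal (rneg (increment X t \<omega>) powr \<beta>)) \<omega> = \<infinity>"
    and "x > 0"
  shows "(\<integral>\<^sup>+ \<omega>. enat_powr (first_passage X x \<omega>) (\<beta> / \<alpha>) \<partial>M) = \<infinity>"
proof -
  interpret prob_space M by fact
  have sub: "subalgebra M (F t)" and Xt [measurable]: "X t \<in> borel_measurable (F t)" for t
    using assms(2) by (auto simp: adapted_process_def)
  have XM [measurable]: "X t \<in> borel_measurable M" for t
    using measurable_from_subalg[OF sub Xt] .
  \<comment> \<open>\<open>C\<close> may be \<open>0\<close>, but the time scale \<open>Y powr \<alpha> / (2 * c)\<close> needs a positive bound.\<close>
  define c where "c = max 1 (enn2real C)"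
  have c: "0 < c" and Cc: "C \<le> ennreal c"
  proof -
    have "C = ennreal (enn2real C)" using assms(7) by simp
    also have "\<dots> \<le> ennreal c" unfolding c_def by (rule ennreal_leI) simp
    finally show "C \<le> ennreal c" .
  qed (simp add: c_def)
  define p where "p = \<beta> / \<alpha>"
  have p: "0 < p" "\<alpha> * p = \<beta>" using assms by (simp_all add: p_def)
  define Y where "Y \<omega> = rneg (X 1 \<omega>)" for \<omega>
  define N where "N \<omega> = nat \<lfloor>Y \<omega> powr \<alpha> / (2 * c)\<rfloor>" for \<omega>
  have NF [measurable]: "N \<in> measurable (F 1) (count_space UNIV)"
    unfolding N_def[abs_def] Y_def[abs_def] by measurable
  have NM [measurable]: "N \<in> measurable M (count_space UNIV)"
    using measurable_from_subalg[OF sub NF] .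
  have N_le: "2 * c * real (N \<omega>) \<le> Y \<omega> powr \<alpha>" for \<omega>
  proof -
    have "real (N \<omega>) \<le> Y \<omega> powr \<alpha> / (2 * c)" unfolding N_def using c by simp
    then show ?thesis using c by (simp add: field_simps)
  qed
  have N_ge: "Y \<omega> powr \<alpha> / (2 * c) \<le> real (Suc (N \<omega>))" for \<omega>
    unfolding N_def using c by linarith
  define B where "B n = {\<omega> \<in> space M. \<forall>t\<le>n. X t \<omega> < x}" for n
  have up: "AE \<omega> in M. nn_cond_exp M (F t) (\<lambda>\<omega>. ennreal (rpos (increment X t \<omega>) powr \<alpha>)) \<omega> \<le> ennreal c" for t
    using assms(8)[of t] Cc by (auto elim: order_trans)
  \<comment> \<open>The depth of the first step has infinite \<open>\<beta>\<close>-th moment, hence so has its rescaled form.\<close>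
  have "\<infinity> = (\<integral>\<^sup>+ \<omega>. nn_cond_exp M (F 0) (\<lambda>\<omega>. ennreal (rneg (increment X 0 \<omega>) powr \<beta>)) \<omega> \<partial>M)"
  proof -
    have "(\<integral>\<^sup>+ \<omega>. nn_cond_exp M (F 0) (\<lambda>\<omega>. ennreal (rneg (increment X 0 \<omega>) powr \<beta>)) \<omega> \<partial>M) = (\<integral>\<^sup>+ \<omega>. \<infinity> \<partial>M)"
      using assms(9)[of 0] by (rule nn_integral_cong_AE)
    then show ?thesis by (simp add: emeasure_space_1)
  qed
  also have "\<dots> = (\<integral>\<^sup>+ \<omega>. ennreal (rneg (increment X 0 \<omega>) powr \<beta>) \<partial>M)"
  proof -
    interpret G: finite_measure_subalgebra M "F 0"
      by unfold_locales (rule sub)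
    have [measurable]: "increment X 0 \<in> borel_measurable M"
      unfolding increment_def[abs_def] by measurable
    show ?thesis
      using G.nn_cond_exp_intg[of "\<lambda>_. 1" "\<lambda>\<omega>. ennreal (rneg (increment X 0 \<omega>) powr \<beta>)"]
      by simp
  qed
  also have "\<dots> = (\<integral>\<^sup>+ \<omega>. ennreal (Y \<omega> powr \<beta>) \<partial>M)"
    using assms(3) by (intro nn_integral_cong) (simp add: Y_def increment_def)
  also have "\<dots> = (\<integral>\<^sup>+ \<omega>. ennreal ((2 * c) powr p) * ennreal ((Y \<omega> powr \<alpha> / (2 * c)) powr p) \<partial>M)"
    using c p by (simp add: powr_divide powr_powr ennreal_mult[symmetric])
  also have "\<dots> = ennreal ((2 * c) powr p) * (\<integral>\<^sup>+ \<omega>. ennreal ((Y \<omega> powr \<alpha> / (2 * c)) powr p) \<partial>M)"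
    unfolding Y_def by (intro nn_integral_cmult) measurable
  finally have "(\<integral>\<^sup>+ \<omega>. ennreal ((Y \<omega> powr \<alpha> / (2 * c)) powr p) \<partial>M) = \<infinity>"
    by (simp add: eq_commute[of top] ennreal_mult_eq_top_iff)
  moreover have "(\<integral>\<^sup>+ \<omega>. ennreal ((Y \<omega> powr \<alpha> / (2 * c)) powr p) \<partial>M)
      \<le> (\<integral>\<^sup>+ \<omega>. ennreal (real (Suc (N \<omega>)) powr p) \<partial>M)"
    using c p by (intro nn_integral_mono ennreal_leI powr_mono2 N_ge) simp_all
  moreover have "\<dots> \<le> 2 * (\<integral>\<^sup>+ \<omega>. enat_powr (first_passage X x \<omega>) p \<partial>M)"
  proof (rule nn_integral_nat_level_le[where N = N and B = B])
    show "B n \<in> sets M" for n unfolding B_def by measurable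
    show "ennreal (real (Suc n) powr p) \<le> enat_powr (first_passage X x \<omega>) p" if "\<omega> \<in> B n" for n \<omega>
      using that p by (intro enat_powr_first_passage_ge) (auto simp: B_def)
    show "emeasure M {\<omega> \<in> space M. N \<omega> = n}
        \<le> 2 * emeasure M ({\<omega> \<in> space M. N \<omega> = n} \<inter> B n)" for n
      unfolding B_def
    proof (rule emeasure_le_twice_emeasure_unpassed[OF assms(1-5) \<open>x > 0\<close> c up])
      have space_F: "space M = space (F 1)" using sub by (simp add: subalgebra_def)
      show "{\<omega> \<in> space M. N \<omega> = n} \<in> sets (F 1)" unfolding space_F by measurable
    qed (use N_le in \<open>auto simp: Y_def\<close>)
  qed (rule NM)
  ultimately show ?thesis by (simp add: p_def top_unique ennreal_mult_eq_top_iff)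
qed

end
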